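(* There exist real constants $c_1$ and $c_2$ with $0<c_1<c_2<1$ such that, for all sufficiently large positive integers $n$, $$c_1 f_1(n)\le f_4(n)\le c_2 f_1(n),$$ where $$f_1(n)=2(n-2)\left(\frac{n(n-3)}{2}+1\right)^2$$ and $$f_4(n)=2\sum_{k=0}^{n-3}\ \sum_{N=0}^{A_n(k)-1}\bigl(M'(N,k)+1\bigr),\qquad A_n(k)=\min\left\{k(n-1)+1,\ \left\lfloor \frac{n^2+5}{2}-2n\right\rfloor\right\}.$$
   Context: The function $M'(N,k)$ is a nonnegative integer function of integers $N\ge 0$, $k\ge 0$, given as follows. If $N=0$ or $k=0$, then $M'(N,k)=0$. If $N,k\ge 1$, let $q=\lfloor N/k\rfloor$ and $r=N \bmod k$ (so $N=qk+r$, $0\le r<k$). Then: - if $k<q$, $M'(N,k)=0$; - if $k\ge q$ and $r\le q$ (including $r=0$), $M'(N,k)=q(k-q+1)-r$; - if $k\ge q$ and $r>q$, $M'(N,k)=q(k-q-1)+r$. Background on the meaning of these quantities (not needed to read the inequality). $f_1(n)$ is the number of elements of the four dimensional array, with dimension sizes $\frac{n(n-3)}{2}+1$, $n-2$, $2$, $\frac{n(n-3)}{2}+1$, used by an earlier dynamic programming algorithm computing the number $L(n)$ of zero-free graphical degree sequences of length $n$ with largest part less than $n-1$. $f_4(n)$ is the number of elements of the ragged four dimensional array $Q$ used by the improved algorithm: its first dimension has size $2$; its second dimension (index $k$, starting at $0$) has size $n-2$; its third dimension (index $N$, starting at $0$) has size $A_n(k)$; its fourth dimension has size $M'(N,k)+1$.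 Thus $f_4(n)$ is the displayed sum. *)

theory Defs
  imports Complex_Main
begin

text \<open>
  \<open>M' N k\<close> is a natural number, but no subtraction truncates: in the branch \<open>r \<le> q\<close>
  we have \<open>q \<le> k\<close> and \<open>r \<le> q \<le> q * (k - q + 1)\<close>, and in the last branch \<open>q < r < k\<close>.
  The lemma \<open>int_M'\<close> restates the definition with integer arithmetic.
\<close>

definition M' :: "nat \<Rightarrow> nat \<Rightarrow> nat" where
  "M' N k =
     (if N = 0 \<or> k = 0 then 0
      else let q = N div k; r = N mod k in
        if k < q then 0
        else if r \<le> q then q * (k - q + 1) - r
        else q * (k - q - 1) + r)"

lemma int_M':
  assumes "N \<ge> 1" "k \<ge> 1"
  defines "q \<equiv> N div k" and "r \<equiv> N mod k"
  shows "int (M' N k) =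
     (if k < q then 0
      else if r \<le> q then int q * (int k - int q + 1) - int r
      else int q * (int k - int q - 1) + int r)"
proof -
  have "r < k" using assms by simp
  have M: "M' N k = (if k < q then 0 else if r \<le> q then q * (k - q + 1) - r
      else q * (k - q - 1) + r)"
    using assms unfolding M'_def by (simp add: Let_def)
  consider "k < q" | "q \<le> k" "r \<le> q" | "q \<le> k" "q < r" by linarith
  then show ?thesis
  proof cases
    case 2
    have "r \<le> q * (k - q + 1)" using \<open>r \<le> q\<close> by simp
    then have "int (q * (k - q + 1) - r) = int q * (int k - int q + 1) - int r"
      using \<open>q \<le> k\<close> by (simp add: of_nat_diff del: mult_Suc_right)
    then show ?thesis using 2 M by simp
  next
    case 3
    then have "int (k - q - 1) = int k - int q - 1" using \<open>r < k\<close> by simp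
    then show ?thesis using 3 M by simp
  qed (use M in simp)
qed

text \<open>
  The floor is never negative, since \<open>(n\<^sup>2 + 5) / 2 - 2 * n = ((n - 2)\<^sup>2 + 1) / 2\<close>,
  so the conversion to \<^typ>\<open>nat\<close> loses nothing.
\<close>

definition A :: "nat \<Rightarrow> nat \<Rightarrow> nat" where
  "A n k = min (k * (n - 1) + 1) (nat \<lfloor>((real n)\<^sup>2 + 5) / 2 - 2 * real n\<rfloor>)"

definition f1 :: "nat \<Rightarrow> real" where
  "f1 n = 2 * (real n - 2) * (real n * (real n - 3) / 2 + 1)\<^sup>2"

text \<open>
  The index ranges \<open>0 \<le> k \<le> n - 3\<close> and \<open>0 \<le> N \<le> A n k - 1\<close> are written with strict upper
  bounds, so that they are empty rather than \<open>{0}\<close> where the upper limit would be negative.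
\<close>

definition f4 :: "nat \<Rightarrow> nat" where
  "f4 n = 2 * (\<Sum>k<n - 2. \<Sum>N<A n k. (M' N k + 1))"

end

theory Submission
  imports Defs
begin

text \<open>
  Both \<open>f1\<close> and \<open>f4\<close> have order \<open>n ^ 5\<close>. For the upper bound, \<open>M' N k\<close> is at most
  \<open>(k + 1)\<^sup>2 / 4\<close>, so every entry of the sum is at most about \<open>n\<^sup>2 / 4\<close>, while there are at most
  about \<open>n\<^sup>3 / 2\<close> entries; this gives \<open>n ^ 5 / 4\<close> against \<open>f1 n \<approx> n ^ 5 / 2\<close>. For the lower bound,
  \<open>M' N k \<ge> q * (k - q)\<close> with \<open>q = N div k\<close>, which is at least \<open>(N - k) / 2\<close> as soon as
  \<open>2 * N \<le> k\<^sup>2\<close>; with \<open>j\<close> about \<open>n / 4\<close>, the box \<open>2 * j \<le> k < 4 * j\<close>, \<open>j\<^sup>2 \<le> N < 2 * j\<^sup>2\<close> already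
  contributes a positive proportion of \<open>n ^ 5\<close>.
\<close>

text \<open>By AM-GM: in either nonzero branch the value is at most a product of two factors with
  sum \<open>k + 1\<close>, namely \<open>q\<close> and \<open>k - q + 1\<close> when
  \<open>r \<le> q\<close>, and \<open>q + 1\<close> and \<open>k - q\<close> when
  \<open>q < r\<close>.\<close>

lemma M'_upper: "4 * M' N k \<le> (k + 1)\<^sup>2"
proof (cases "N = 0 \<or> k = 0 \<or> k < N div k")
  case True
  then show ?thesis by (auto simp: M'_def)
next
  case False
  define q r where "q = N div k" and "r = N mod k"
  have k: "q \<le> k" "r < k"
    using False by (auto simp: q_def r_def)
  have M: "M' N k = (if r \<le> q then q * (k - q + 1) - r else q * (k - q - 1) + r)"
    using False by (auto simp: M'_def Let_def q_def r_def)
  have amgm: "4 * (a * b) \<le> (a + b)\<^sup>2" for a b :: nat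
  proof -
    have "0 \<le> (int a - int b)\<^sup>2" by simp
    then have "int (4 * (a * b)) \<le> int ((a + b)\<^sup>2)"
      by (simp add: power2_eq_square algebra_simps)
    then show ?thesis by (simp only: of_nat_le_iff)
  qed
  show ?thesis
  proof (cases "r \<le> q")
    case True
    then have "4 * M' N k \<le> 4 * (q * (k - q + 1))" using M by simp
    also have "\<dots> \<le> (k + 1)\<^sup>2"
      using amgm[of q "k - q + 1"] k by simp
    finally show ?thesis .
  next
    case False
    define e where "e = k - q - 1"
    have e: "k = q + e + 1" using False k by (simp add: e_def)
    have "M' N k = q * e + r" using M False by (simp add: e_def)
    also have "\<dots> \<le> (q + 1) * (e + 1)" using k e by (simp add: algebra_simps)
    finally show ?thesis
      using amgm[of "q + 1" "e + 1"] e by simp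
  qed
qed

lemma M'_lower:
  assumes "0 < k" "2 * N \<le> k\<^sup>2"
  shows "N \<le> 2 * M' N k + k"
proof (cases "N = 0")
  case False
  define q r where "q = N div k" and "r = N mod k"
  have N: "N = k * q + r" and r: "r < k"
    using assms by (auto simp: q_def r_def)
  have "k * (2 * q) \<le> k * k"
    by (rule order_trans[OF _ assms(2)[unfolded power2_eq_square]]) (simp add: N algebra_simps)
  then have q: "2 * q \<le> k" using assms(1) by (simp only: mult_le_cancel1)
  have M: "int (M' N k) = (if r \<le> q then int q * (int k - int q + 1) - int r
      else int q * (int k - int q - 1) + int r)"
    using int_M'[of N k] False assms(1) q by (simp add: q_def r_def)
  \<comment> \<open>The excess over \<open>q * (k - q)\<close> is \<open>q - r\<close> in the first
    branch and \<open>r - q\<close> in the second, so it is never negative.\<close>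
  have "int q * (int k - int q) \<le> int (M' N k)"
    unfolding M by (simp add: algebra_simps)
  moreover have "int q * int k \<le> int q * (2 * (int k - int q))"
    using q by (intro mult_left_mono) auto
  ultimately have "int k * int q \<le> 2 * int (M' N k)"
    by (simp add: algebra_simps)
  then have "int N \<le> 2 * int (M' N k) + int k"
    using N r by simp
  then show ?thesis by linarith
qed simp

text \<open>With \<open>n = m + 2\<close>, the factor n(n - 3)/2 + 1 equals (n - 1)(n - 2)/2 = m(m +
  1)/2.\<close>

lemma f1_eq: "f1 (m + 2) = real m * (real m * (real m + 1))\<^sup>2 / 2"
  by (simp add: f1_def power2_eq_square field_simps)

lemma floor_arg_eq: "((real (m + 2))\<^sup>2 + 5) / 2 - 2 * real (m + 2) = ((real m)\<^sup>2 + 1) / 2"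
  by (simp add: power2_eq_square field_simps)

lemma A_upper: "real (A (m + 2) k) \<le> ((real m)\<^sup>2 + 1) / 2"
proof -
  have "A (m + 2) k \<le> nat \<lfloor>((real m)\<^sup>2 + 1) / 2\<rfloor>"
    unfolding A_def floor_arg_eq by simp
  then have "real (A (m + 2) k) \<le> real (nat \<lfloor>((real m)\<^sup>2 + 1) / 2\<rfloor>)"
    by (simp only: of_nat_le_iff)
  also have "\<dots> \<le> ((real m)\<^sup>2 + 1) / 2"
    by (intro of_nat_floor) simp
  finally show ?thesis .
qed

lemma A_lower:
  assumes "L \<le> k * (m + 1)" "2 * L \<le> m\<^sup>2"
  shows "L \<le> A (m + 2) k"
proof -
  have "2 * real L \<le> (real m)\<^sup>2"
    using assms(2) by (metis of_nat_le_iff of_nat_mult of_nat_numeral of_nat_power)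
  then have "int L \<le> \<lfloor>((real m)\<^sup>2 + 1) / 2\<rfloor>"
    by (simp add: le_floor_iff)
  then have "L \<le> nat \<lfloor>((real m)\<^sup>2 + 1) / 2\<rfloor>" by linarith
  then show ?thesis
    unfolding A_def floor_arg_eq using assms(1) by simp
qed

lemma f4_upper: "real (f4 (m + 2)) \<le> real m * ((real m)\<^sup>2 + 1) * ((real m)\<^sup>2 + 4) / 4"
proof -
  have entry: "real (M' N k + 1) \<le> ((real m)\<^sup>2 + 4) / 4" if "k < m" for N k
  proof -
    have "4 * M' N k \<le> m\<^sup>2"
      using M'_upper[of N k] power_mono[of "k + 1" m 2] that by linarith
    then have "real (4 * M' N k) \<le> real (m\<^sup>2)" by (simp only: of_nat_le_iff)
    then show ?thesis by simp
  qed
  have row: "(\<Sum>N<A (m + 2) k. real (M' N k + 1)) \<le> ((real m)\<^sup>2 + 1) / 2 * (((real m)\<^sup>2 + 4) / 4)"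
    if "k < m" for k
  proof -
    have "(\<Sum>N<A (m + 2) k. real (M' N k + 1)) \<le> real (A (m + 2) k) * (((real m)\<^sup>2 + 4) / 4)"
      using sum_bounded_above[of "{..<A (m + 2) k}", OF entry[OF that]] by simp
    also have "\<dots> \<le> ((real m)\<^sup>2 + 1) / 2 * (((real m)\<^sup>2 + 4) / 4)"
      by (intro mult_right_mono A_upper) simp
    finally show ?thesis .
  qed
  have "real (f4 (m + 2)) = 2 * (\<Sum>k<m. \<Sum>N<A (m + 2) k. real (M' N k + 1))"
    by (simp add: f4_def)
  also have "\<dots> \<le> 2 * (real m * (((real m)\<^sup>2 + 1) / 2 * (((real m)\<^sup>2 + 4) / 4)))"
    using sum_bounded_above[of "{..<m}" "\<lambda>k. \<Sum>N<A (m + 2) k. real (M' N k + 1)", OF row]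
    by simp
  finally show ?thesis by (simp add: field_simps)
qed

lemma f4_lower:
  assumes "4 * j \<le> m" "8 \<le> j"
  shows "j ^ 5 \<le> f4 (m + 2)"
proof -
  have row: "j\<^sup>2 * j\<^sup>2 \<le> (\<Sum>N<A (m + 2) k. 4 * (M' N k + 1))"
    if k: "k \<in> {2 * j..<4 * j}" for k
  proof -
    have "2 * j\<^sup>2 \<le> k * (m + 1)"
      using mult_mono[of "2 * j" k j "m + 1"] k assms by (simp add: power2_eq_square)
    moreover have "2 * (2 * j\<^sup>2) \<le> m\<^sup>2"
      using power_mono[OF assms(1), of 2] by (simp add: power_mult_distrib)
    ultimately have A: "2 * j\<^sup>2 \<le> A (m + 2) k" by (rule A_lower)
    \<comment> \<open>Here \<open>8 \<le> j\<close> enters: \<open>k < 4 * j\<close> is then at most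
      half of \<open>j\<^sup>2\<close>, so at least half of \<open>N\<close> survives in
      \<open>N - k \<le> 2 * M' N k\<close>. Scaling by 4 keeps the bound in the naturals.\<close>
    have entry: "j\<^sup>2 \<le> 4 * (M' N k + 1)" if N: "N \<in> {j\<^sup>2..<2 * j\<^sup>2}" for N
    proof -
      have "2 * N \<le> k\<^sup>2"
        using power_mono[of "2 * j" k 2] k N by (simp add: power_mult_distrib)
      then have "N \<le> 2 * M' N k + k"
        using M'_lower k assms by simp
      moreover have "8 * j \<le> j\<^sup>2" using assms(2) by (simp add: power2_eq_square)
      moreover have "k < 4 * j" "j\<^sup>2 \<le> N" using k N by auto
      ultimately show ?thesis unfolding distrib_left by linarith
    qed
    have "j\<^sup>2 * j\<^sup>2 \<le> (\<Sum>N = j\<^sup>2..<2 * j\<^sup>2. 4 * (M' N k + 1))"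
      using sum_bounded_below[of "{j\<^sup>2..<2 * j\<^sup>2}", OF entry] by simp
    also have "\<dots> \<le> (\<Sum>N<A (m + 2) k. 4 * (M' N k + 1))"
      using A by (intro sum_mono2) auto
    finally show ?thesis .
  qed
  have "2 * j * (j\<^sup>2 * j\<^sup>2) \<le> (\<Sum>k = 2 * j..<4 * j. \<Sum>N<A (m + 2) k. 4 * (M' N k + 1))"
    using sum_bounded_below[of "{2 * j..<4 * j}", OF row] by simp
  also have "\<dots> \<le> (\<Sum>k<m. \<Sum>N<A (m + 2) k. 4 * (M' N k + 1))"
    using assms by (intro sum_mono2) auto
  \<comment> \<open>The scaling by 4 absorbs the factor 2 in \<open>f4\<close> and leaves another 2,
    which cancels against the \<open>2 * j\<close> rows of the box.\<close>
  also have "\<dots> = 2 * f4 (m + 2)"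
    unfolding f4_def sum_distrib_left[symmetric] by simp
  finally have "2 * j * (j\<^sup>2 * j\<^sup>2) \<le> 2 * f4 (m + 2)" .
  moreover have "2 * j * (j\<^sup>2 * j\<^sup>2) = 2 * j ^ 5"
    by (simp flip: power_add power_Suc)
  ultimately show ?thesis by linarith
qed

theorem theorem4p1:
  shows "\<exists>c1 c2 :: real. 0 < c1 \<and> c1 < c2 \<and> c2 < 1 \<and>
    (\<forall>\<^sub>F n in sequentially. c1 * f1 n \<le> real (f4 n) \<and> real (f4 n) \<le> c2 * f1 n)"
proof (intro exI conjI)
  \<comment> \<open>The lower estimate gives \<open>f1 n \<le> 5 ^ 5 / 2 * f4 n\<close>, and 2000
    exceeds 3125/2. The ratio of the leading terms in the upper estimate is 1/2, so 3/4 leaves room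
    for lower-order terms.\<close>
  show "\<forall>\<^sub>F n in sequentially. 1 / 2000 * f1 n \<le> real (f4 n) \<and> real (f4 n) \<le> 3 / 4 * f1 n"
    using eventually_ge_at_top[of 34]
  proof eventually_elim
    case (elim n)
    define m j where "m = n - 2" and "j = m div 4"
    have n: "n = m + 2" and m: "32 \<le> m"
      using elim by (auto simp: m_def)
    \<comment> \<open>Since \<open>m \<le> 4 * j + 3\<close>, the last bound needs only
      \<open>4 \<le> j\<close>; the threshold 34 comes from \<open>8 \<le> j\<close>.\<close>
    have j: "8 \<le> j" "4 * j \<le> m" "m + 1 \<le> 5 * j"
      using m by (auto simp: j_def)
    have m5: "real m + 1 \<le> 5 * real j" using j(3) by linarith
    have "f1 n \<le> (5 * real j) * ((5 * real j) * (5 * real j))\<^sup>2 / 2"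
      unfolding n f1_eq using m5
      by (intro divide_right_mono mult_mono power_mono) auto
    also have "\<dots> = 3125 / 2 * real j ^ 5"
      by (simp add: power2_eq_square eval_nat_numeral)
    also have "\<dots> \<le> 3125 / 2 * real (f4 n)"
    proof -
      have "real (j ^ 5) \<le> real (f4 n)"
        unfolding n using f4_lower[OF j(2,1)] by (simp only: of_nat_le_iff)
      then show ?thesis by simp
    qed
    finally have lower: "1 / 2000 * f1 n \<le> real (f4 n)" by simp
    have "32\<^sup>2 \<le> (real m)\<^sup>2" using m by (intro power_mono) auto
    then have "32\<^sup>2 * (real m)\<^sup>2 \<le> (real m)\<^sup>2 * (real m)\<^sup>2"
      by (intro mult_right_mono) auto
    \<comment> \<open>With x = m^2 this reads x^2 + 5x + 4 \<le> 3x^2/2, where 5x + 4 is absorbed by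
      x^2/2 because x \<ge> 1024.\<close>
    then have "((real m)\<^sup>2 + 1) * ((real m)\<^sup>2 + 4) \<le> 3 / 2 * ((real m)\<^sup>2 * (real m)\<^sup>2)"
      using \<open>32\<^sup>2 \<le> (real m)\<^sup>2\<close> by (simp add: algebra_simps)
    also have "\<dots> \<le> 3 / 2 * (real m * (real m + 1))\<^sup>2"
      unfolding power_mult_distrib by (intro mult_left_mono power_mono) auto
    finally have "real m * (((real m)\<^sup>2 + 1) * ((real m)\<^sup>2 + 4))
        \<le> real m * (3 / 2 * (real m * (real m + 1))\<^sup>2)"
      by (rule mult_left_mono) simp
    then have "real (f4 n) \<le> 3 / 4 * f1 n"
      using f4_upper[of m] unfolding n f1_eq mult.assoc by linarith
    with lower show ?case by simp
  qed
qed simp_all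

end
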